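(* Let $N \geq 1$ be an integer, let $1 < p < +\infty$, and suppose that $\alpha := 1 + \frac{N}{p}$ satisfies $\alpha < N$. Then for any $1 \leq q < p$ there exists a constant $C = C(q, \alpha, N)$ such that $$|\tilde{I}_\alpha f(x) - \tilde{I}_\alpha f(z)| \leq C|x-z|\,\bigl(|\ln|x-z||+1\bigr)^{\frac{1}{p'}}\left(\|f\|_{L^q(\mathbb{R}^N)} + \|f\|_{L^p(\mathbb{R}^N)}\right)$$ for all $f \in L^p(\mathbb{R}^N) \cap L^q(\mathbb{R}^N)$ and all $x, z \in \mathbb{R}^N$.
   Context: Here $p' = \frac{p}{p-1}$ is the conjugate exponent, and when $x = z$ the right-hand side is understood as $0$. For $0 < \alpha < N$ the modified Riesz potential of a function $f$ is $$\tilde{I}_\alpha f(x) := \gamma(N, \alpha) \int_{\mathbb{R}^N} f(y) \left[\frac{1}{|x-y|^{N-\alpha}} - \frac{1}{|y|^{N-\alpha}}\right] dy, \qquad \gamma(N,\alpha) := \frac{\Gamma(\frac{N-\alpha}{2})}{\pi^{\frac{N}{2}} 2^\alpha \Gamma(\frac{\alpha}{2})}.$$ *)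

theory Defs
  imports "HOL-Analysis.Analysis"
begin

text \<open>Elements of \<open>L\<^sup>p(\<real>\<^sup>N)\<close> are represented by Lebesgue measurable functions, not by classes
  modulo equality almost everywhere; everything below is invariant under changing \<open>f\<close> on a null
  set. The definitions are meant for \<open>1 \<le> p < \<infinity>\<close>; note that \<open>0 powr p = 0\<close>.\<close>

definition Lp_space :: "real \<Rightarrow> (real ^ 'n \<Rightarrow> real) set" where
  "Lp_space p = {f. f \<in> borel_measurable lebesgue \<and> integrable lebesgue (\<lambda>x. \<bar>f x\<bar> powr p)}"

definition Lp_norm :: "real \<Rightarrow> (real ^ 'n \<Rightarrow> real) \<Rightarrow> real" where
  "Lp_norm p f = (LINT x|lebesgue. \<bar>f x\<bar> powr p) powr (1 / p)"

definition riesz_const :: "nat \<Rightarrow> real \<Rightarrow> real" where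
  "riesz_const N \<alpha> =
     Gamma ((real N - \<alpha>) / 2) / (pi powr (real N / 2) * 2 powr \<alpha> * Gamma (\<alpha> / 2))"

text \<open>The kernel takes the value \<open>1 / 0 = 0\<close> at its singularities \<open>y = x\<close> and \<open>y = 0\<close>,
  which form a null set.\<close>

definition modified_riesz_potential ::
    "real \<Rightarrow> (real ^ 'n \<Rightarrow> real) \<Rightarrow> real ^ 'n \<Rightarrow> real" where
  "modified_riesz_potential \<alpha> f x =
     riesz_const CARD('n) \<alpha> *
     (LINT y|lebesgue. f y * (1 / norm (x - y) powr (real CARD('n) - \<alpha>)
                              - 1 / norm y powr (real CARD('n) - \<alpha>)))"

definition conjugate_exponent :: "real \<Rightarrow> real" where
  "conjugate_exponent p = p / (p - 1)"

end

theory Submission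
  imports Defs
begin

text \<open>Put \<open>\<beta> = N - \<alpha>\<close> and \<open>h = |x - z|\<close>; the choice of \<open>\<alpha>\<close> amounts to \<open>(\<beta> + 1) p' = N\<close>. The
  difference of the potentials is the integral of \<open>f\<close> against \<open>|x - y|\<^sup>-\<^sup>\<beta> - |z - y|\<^sup>-\<^sup>\<beta>\<close>. Within
  distance \<open>2h\<close> of \<open>x\<close> both terms are estimated separately by Hoelder's inequality, which gives
  a factor \<open>h\<close>. Further away the mean value theorem bounds the kernel by a multiple of
  \<open>h |x - y|\<^sup>-\<^sup>\<beta>\<^sup>-\<^sup>1\<close>, and the \<open>p'\<close>-th power of \<open>|x - y|\<^sup>-\<^sup>\<beta>\<^sup>-\<^sup>1\<close> is the borderline function
  \<open>|x - y|\<^sup>-\<^sup>N\<close>: its integral over \<open>h \<le> |x - y| \<le> 1\<close> produces the logarithm. The part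
  \<open>|x - y| \<ge> 1\<close> is controlled by the \<open>L\<^sup>q\<close> norm, because \<open>q' > p'\<close> makes the kernel
  \<open>q'\<close>-integrable (bounded if \<open>q = 1\<close>) there.\<close>

section \<open>Integration of radial functions\<close>

text \<open>This is integration in polar coordinates without a measure on the sphere. The volume of
  a ball is a multiple of \<open>t ^ DIM('a)\<close>, and the density is its derivative in
  \<open>t\<close>. Hence both measures agree on the half-lines \<open>{..t}\<close>, which form an
  intersection-stable generator of the Borel sets.\<close>

lemma distr_norm_eq_density_powr:
  fixes x :: "'a::euclidean_space"
  defines "c \<equiv> real DIM('a) * unit_ball_vol (real DIM('a))"
  shows "distr lborel borel (\<lambda>y. norm (x - y)) =
    density lborel (\<lambda>t. ennreal (c * t powr (real DIM('a) - 1)) * indicator {0..} t)"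
    (is "?M = ?D")
proof (rule measure_eqI_generator_eq[where E = "range atMost" and \<Omega> = UNIV and A = "\<lambda>i. {..real i}"])
  have c: "0 \<le> c" by (simp add: c_def)
  have M: "emeasure ?M {..t} =
    (if t < 0 then 0 else ennreal (unit_ball_vol (real DIM('a)) * t ^ DIM('a)))" for t
  proof -
    have "emeasure ?M {..t} = emeasure lborel (cball x t)"
      by (subst emeasure_distr) (auto simp: cball_def dist_norm vimage_def)
    then show ?thesis by (auto simp: emeasure_cball)
  qed
  have D: "emeasure ?D {..t} =
    (if t < 0 then 0 else ennreal (unit_ball_vol (real DIM('a)) * t ^ DIM('a)))" for t
  proof -
    let ?w = "\<lambda>s. ennreal (c * s powr (real DIM('a) - 1))"
    have "emeasure ?D {..t} = (\<integral>\<^sup>+s. ?w s * indicator {0..} s * indicator {..t} s \<partial>lborel)"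
      by (rule emeasure_density) measurable
    also have "\<dots> = (\<integral>\<^sup>+s. ?w s * indicator {0..t} s \<partial>lborel)"
      by (rule nn_integral_cong) (simp add: indicator_def)
    finally have *: "emeasure ?D {..t} = (\<integral>\<^sup>+s. ?w s * indicator {0..t} s \<partial>lborel)" .
    show ?thesis
    proof (cases "t < 0")
      case True
      with * show ?thesis by simp
    next
      case False
      \<comment> \<open>The exponent is nonnegative because the dimension is at least 1. The factor
        \<open>real DIM('a)\<close> in \<open>c\<close> then cancels the denominator and leaves the
        volume of the ball.\<close>
      have "((\<lambda>s. s powr (real DIM('a) - 1)) has_integral
          (t powr (real DIM('a) - 1 + 1) / (real DIM('a) - 1 + 1))) {0..t}"
        using False by (intro has_integral_powr_from_0) auto
      from has_integral_mult_right[OF this, of c]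
      have "((\<lambda>s. c * s powr (real DIM('a) - 1)) has_integral
          (unit_ball_vol (real DIM('a)) * t ^ DIM('a))) {0..t}"
        using False by (auto simp: c_def powr_realpow')
      from nn_integral_has_integral_lebesgue'[OF _ this] c
      have "(\<integral>\<^sup>+s. ?w s * indicator {0..t} s \<partial>lborel) =
        ennreal (unit_ball_vol (real DIM('a)) * t ^ DIM('a))" by simp
      with * False show ?thesis by simp
    qed
  qed
  show "emeasure ?M X = emeasure ?D X" if "X \<in> range atMost" for X
    using that M D by auto
  show "emeasure ?M {..real i} \<noteq> \<infinity>" for i
    unfolding M by simp
  show "(\<Union>i. {..real i}) = UNIV"
    by (auto intro: real_arch_simple)
  show "Int_stable (range (atMost :: real \<Rightarrow> _))"
    by (auto simp: Int_stable_def)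
  show "sets ?M = sigma_sets UNIV (range atMost)" "sets ?D = sigma_sets UNIV (range atMost)"
    by (simp_all add: borel_eq_atMost)
qed auto

lemma nn_integral_radial:
  fixes x :: "'a::euclidean_space" and g :: "real \<Rightarrow> ennreal"
  assumes [measurable]: "g \<in> borel_measurable borel"
  shows "(\<integral>\<^sup>+y. g (norm (x - y)) \<partial>lebesgue) =
    ennreal (real DIM('a) * unit_ball_vol (real DIM('a))) *
      (\<integral>\<^sup>+t. ennreal (t powr (real DIM('a) - 1)) * g t * indicator {0..} t \<partial>lborel)"
proof -
  have "(\<integral>\<^sup>+y. g (norm (x - y)) \<partial>lebesgue) =
      (\<integral>\<^sup>+t. g t \<partial>distr lborel borel (\<lambda>y. norm (x - y)))"
    by (simp add: nn_integral_completion nn_integral_distr)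
  also have "\<dots> = (\<integral>\<^sup>+t. ennreal (real DIM('a) * unit_ball_vol (real DIM('a))) *
      (ennreal (t powr (real DIM('a) - 1)) * g t * indicator {0..} t) \<partial>lborel)"
    unfolding distr_norm_eq_density_powr
    by (subst nn_integral_density) (auto intro!: nn_integral_cong simp: ennreal_mult mult_ac)
  finally show ?thesis
    by (simp add: nn_integral_cmult)
qed

section \<open>Hoelder's inequality for nonnegative integrals\<close>

text \<open>Young's inequality is applied to the normalised functions \<open>f / a\<close> and
  \<open>g / b\<close> and then integrated. The numbers \<open>A\<close> and \<open>B\<close> merely
  bound the two integrals, so a kernel integral may be replaced by a convenient larger value. For
  \<open>A = 0\<close>, where normalising is impossible, \<open>f\<close> vanishes almost
  everywhere.\<close>

lemma nn_integral_Holder: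
  fixes f g :: "'a \<Rightarrow> real"
  assumes [measurable]: "f \<in> borel_measurable M" "g \<in> borel_measurable M"
    and f0: "\<And>x. 0 \<le> f x" and g0: "\<And>x. 0 \<le> g x"
    and p: "1 < p" and p': "1 < p'" and pp': "1 / p + 1 / p' = 1"
    and A: "(\<integral>\<^sup>+x. ennreal (f x powr p) \<partial>M) \<le> ennreal A" "0 \<le> A"
    and B: "(\<integral>\<^sup>+x. ennreal (g x powr p') \<partial>M) \<le> ennreal B" "0 < B"
  shows "(\<integral>\<^sup>+x. ennreal (f x * g x) \<partial>M) \<le> ennreal (A powr (1 / p) * B powr (1 / p'))"
proof (cases "A = 0")
  case True
  then have "(\<integral>\<^sup>+x. ennreal (f x powr p) \<partial>M) = 0" using A by simp
  then have "AE x in M. ennreal (f x powr p) = 0"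
    by (subst (asm) nn_integral_0_iff_AE) auto
  then have "AE x in M. ennreal (f x * g x) = 0"
    by eventually_elim (auto simp: ennreal_eq_0_iff)
  then have "(\<integral>\<^sup>+x. ennreal (f x * g x) \<partial>M) = 0"
    by (subst nn_integral_0_iff_AE) auto
  then show ?thesis by simp
next
  case False
  then have Apos: "A > 0" using A by simp
  define a where "a = A powr (1 / p)"
  define b where "b = B powr (1 / p')"
  have a: "a > 0" "a powr p = A" and b: "b > 0" "b powr p' = B"
    using Apos B p p' by (auto simp: a_def b_def powr_powr)
  have young: "f x * g x \<le> (a * b / p / A) * f x powr p + (a * b / p' / B) * g x powr p'" for x
  proof -
    have "(f x / a) * (g x / b) \<le> (f x / a) powr p / p + (g x / b) powr p' / p'"
      using a b f0 g0 p p' pp' by (intro Youngs_inequality) auto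
    then have "(a * b) * ((f x / a) * (g x / b)) \<le>
        (a * b) * ((f x / a) powr p / p + (g x / b) powr p' / p')"
      using a b by (intro mult_left_mono) auto
    then show ?thesis
      using a b f0 g0 p p' by (simp add: powr_divide field_simps)
  qed
  have "(\<integral>\<^sup>+x. ennreal (f x * g x) \<partial>M) \<le>
      (\<integral>\<^sup>+x. ennreal (a * b / p / A) * ennreal (f x powr p) +
        ennreal (a * b / p' / B) * ennreal (g x powr p') \<partial>M)"
    using young a b p p' Apos B(2)
    by (intro nn_integral_mono)
       (auto simp flip: ennreal_mult ennreal_plus intro!: ennreal_leI)
  also have "\<dots> = ennreal (a * b / p / A) * (\<integral>\<^sup>+x. ennreal (f x powr p) \<partial>M) +
      ennreal (a * b / p' / B) * (\<integral>\<^sup>+x. ennreal (g x powr p') \<partial>M)"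
    by (simp add: nn_integral_add nn_integral_cmult)
  also have "\<dots> \<le> ennreal (a * b / p / A) * ennreal A + ennreal (a * b / p' / B) * ennreal B"
    by (intro add_mono mult_left_mono A B) auto
  also have "\<dots> = ennreal (a * b / p / A * A + a * b / p' / B * B)"
    using a b p p' Apos B(2) by (simp flip: ennreal_mult ennreal_plus)
  \<comment> \<open>The normalisation makes \<open>A\<close> and \<open>B\<close> cancel, so the
    weights of Young's inequality add up to 1.\<close>
  also have "a * b / p / A * A + a * b / p' / B * B = a * b * (1 / p + 1 / p')"
    using Apos B(2) p p' by (simp add: field_simps)
  finally show ?thesis by (simp only: pp' a_def b_def mult_1_right)
qed

section \<open>Integrals of powers of the distance\<close>

text \<open>In radial form the integrand is \<open>t powr (real DIM('a) - 1 - a)\<close> on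
  \<open>{0..r}\<close>, whose exponent exceeds -1. Combining the two powers is also correct at
  \<open>t = 0\<close>, since \<open>0 powr _ = 0\<close>.\<close>

lemma nn_integral_norm_powr_ball:
  fixes x :: "'a::euclidean_space" and a r :: real
  assumes "0 \<le> r" "a < real DIM('a)"
  shows "(\<integral>\<^sup>+y. ennreal (if norm (x - y) \<le> r then norm (x - y) powr (- a) else 0) \<partial>lebesgue) =
    ennreal (real DIM('a) * unit_ball_vol DIM('a) * (r powr (real DIM('a) - a) / (real DIM('a) - a)))"
proof -
  have "(\<integral>\<^sup>+t. ennreal (t powr (real DIM('a) - 1)) *
      ennreal (if t \<le> r then t powr (- a) else 0) * indicator {0..} t \<partial>lborel) =
    (\<integral>\<^sup>+t. ennreal (t powr (real DIM('a) - 1 - a)) * indicator {0..r} t \<partial>lborel)"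
    by (intro nn_integral_cong)
       (auto simp: indicator_def powr_diff powr_minus divide_inverse simp flip: ennreal_mult)
  also have "\<dots> = ennreal (r powr (real DIM('a) - 1 - a + 1) / (real DIM('a) - 1 - a + 1))"
    using assms
    by (intro nn_integral_has_integral_lebesgue' has_integral_powr_from_0) auto
  finally show ?thesis
    using assms by (subst nn_integral_radial) (auto simp flip: ennreal_mult)
qed

text \<open>At the borderline exponent the radial weight turns the integrand into
  \<open>1 / t\<close>. This is where the logarithm of the final estimate arises.\<close>

lemma nn_integral_norm_powr_annulus:
  fixes x :: "'a::euclidean_space" and r R :: real
  assumes "0 < r" "r \<le> R"
  shows "(\<integral>\<^sup>+y. ennreal (if r \<le> norm (x - y) \<and> norm (x - y) \<le> R
      then norm (x - y) powr (- real DIM('a)) else 0) \<partial>lebesgue) =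
    ennreal (real DIM('a) * unit_ball_vol DIM('a) * (ln R - ln r))"
proof -
  have "(\<integral>\<^sup>+t. ennreal (t powr (real DIM('a) - 1)) *
      ennreal (if r \<le> t \<and> t \<le> R then t powr (- real DIM('a)) else 0) * indicator {0..} t \<partial>lborel) =
    (\<integral>\<^sup>+t. ennreal (1 / t) * indicator {r..R} t \<partial>lborel)"
    using assms
    by (intro nn_integral_cong)
       (auto simp: indicator_def powr_diff powr_minus divide_inverse simp flip: ennreal_mult)
  also have "\<dots> = ennreal (ln R - ln r)"
    using assms
    by (intro nn_integral_has_integral_lebesgue' fundamental_theorem_of_calculus)
       (auto intro!: derivative_eq_intros simp flip: has_real_derivative_iff_has_vector_derivative)
  finally show ?thesis
    using assms by (subst nn_integral_radial) (auto simp flip: ennreal_mult)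
qed

text \<open>Here the radial exponent lies below -1, which gives convergence at infinity.\<close>

lemma nn_integral_norm_powr_outside_ball:
  fixes x :: "'a::euclidean_space" and a r :: real
  assumes "0 < r" "real DIM('a) < a"
  shows "(\<integral>\<^sup>+y. ennreal (if r \<le> norm (x - y) then norm (x - y) powr (- a) else 0) \<partial>lebesgue) =
    ennreal (real DIM('a) * unit_ball_vol DIM('a) * (r powr (real DIM('a) - a) / (a - real DIM('a))))"
proof -
  have "(\<integral>\<^sup>+t. ennreal (t powr (real DIM('a) - 1)) *
      ennreal (if r \<le> t then t powr (- a) else 0) * indicator {0..} t \<partial>lborel) =
    (\<integral>\<^sup>+t. ennreal (t powr (real DIM('a) - 1 - a)) * indicator {r..} t \<partial>lborel)"
    using assms
    by (intro nn_integral_cong)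
       (auto simp: indicator_def powr_diff powr_minus divide_inverse simp flip: ennreal_mult)
  also have "\<dots> = ennreal (- (r powr (real DIM('a) - 1 - a + 1)) / (real DIM('a) - 1 - a + 1))"
    using assms
    by (intro nn_integral_has_integral_lebesgue' has_integral_powr_to_inf) auto
  also have "- (r powr (real DIM('a) - 1 - a + 1)) / (real DIM('a) - 1 - a + 1) =
      r powr (real DIM('a) - a) / (a - real DIM('a))"
    using assms by (simp add: field_simps)
  finally show ?thesis
    using assms by (subst nn_integral_radial) (auto simp flip: ennreal_mult)
qed

section \<open>Mean value estimate for inverse powers\<close>

text \<open>From \<open>h \<le> a / 2\<close> it follows that \<open>b \<ge> a / 2\<close>. On
  \<open>{a / 2..}\<close> the derivative of \<open>t powr (- \<beta>)\<close> is largest in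
  absolute value at the left endpoint. Rewriting the power of \<open>a / 2\<close> there produces
  the factor \<open>2 powr (\<beta> + 1)\<close>.\<close>

lemma inverse_powr_diff_bound:
  fixes a b h \<beta> :: real
  assumes "0 < \<beta>" "0 < h" "\<bar>a - b\<bar> \<le> h" "2 * h \<le> a"
  shows "\<bar>1 / a powr \<beta> - 1 / b powr \<beta>\<bar> \<le> \<beta> * 2 powr (\<beta> + 1) * h * a powr (- (\<beta> + 1))"
proof -
  have half: "a / 2 \<le> b" "0 < a" "0 < b" using assms by auto
  have "norm (a powr (- \<beta>) - b powr (- \<beta>)) \<le> \<beta> * (a / 2) powr (- \<beta> - 1) * norm (a - b)"
  proof (rule field_differentiable_bound[where S = "{a / 2..}"])
    fix t assume t: "t \<in> {a / 2..}"
    then have "t > 0" using half by auto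
    then show "((\<lambda>t. t powr (- \<beta>)) has_field_derivative (- \<beta> * t powr (- \<beta> - 1)))
        (at t within {a / 2..})"
      by (auto intro!: derivative_eq_intros)
    show "norm (- \<beta> * t powr (- \<beta> - 1)) \<le> \<beta> * (a / 2) powr (- \<beta> - 1)"
      using t half assms by (auto simp: abs_mult intro!: mult_left_mono powr_mono2')
  qed (use half in auto)
  also have "\<dots> \<le> \<beta> * (a / 2) powr (- \<beta> - 1) * h"
    using assms by (intro mult_left_mono) auto
  also have "(a / 2) powr (- \<beta> - 1) = 2 powr (\<beta> + 1) * a powr (- (\<beta> + 1))"
  proof -
    have "(a / 2) powr (- (\<beta> + 1)) = a powr (- (\<beta> + 1)) / 2 powr (- (\<beta> + 1))"
      by (rule powr_divide)
    also have "\<dots> = 2 powr (\<beta> + 1) * a powr (- (\<beta> + 1))"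
      unfolding powr_minus_divide[of 2] by simp
    finally show ?thesis by simp
  qed
  finally have "\<bar>a powr (- \<beta>) - b powr (- \<beta>)\<bar> \<le>
      \<beta> * (2 powr (\<beta> + 1) * a powr (- (\<beta> + 1))) * h" by simp
  also have "\<dots> = \<beta> * 2 powr (\<beta> + 1) * h * a powr (- (\<beta> + 1))" by algebra
  finally show ?thesis unfolding powr_minus_divide[of _ \<beta>] .
qed

section \<open>Hoelder's inequality in terms of \<open>Lp_norm\<close>\<close>

text \<open>Membership in \<open>Lp_space\<close> supplies integrability, so the Bochner integral
  inside \<open>Lp_norm\<close> is the true value rather than the default 0. All estimates can then
  be carried out with nonnegative integrals.\<close>

lemma nn_integral_Lp:
  assumes "f \<in> Lp_space p" "0 < p"
  shows "(\<integral>\<^sup>+x. ennreal (\<bar>f x\<bar> powr p) \<partial>lebesgue) = ennreal (Lp_norm p f powr p)"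
proof -
  have "0 \<le> (LINT x|lebesgue. \<bar>f x\<bar> powr p)" by (intro integral_nonneg_AE) auto
  then show ?thesis
    using assms by (subst nn_integral_eq_integral) (auto simp: Lp_space_def Lp_norm_def powr_powr)
qed

lemma Lp_norm_nonneg: "0 \<le> Lp_norm p f"
  by (simp add: Lp_norm_def)

lemma conjugate_exponent_props:
  assumes "1 < p"
  shows "1 < conjugate_exponent p" "1 / p + 1 / conjugate_exponent p = 1"
  using assms by (auto simp: conjugate_exponent_def field_simps)

lemma Lp_Holder:
  fixes f g :: "real ^ 'n \<Rightarrow> real"
  assumes f: "f \<in> Lp_space p" and p: "1 < p"
    and g_borel: "g \<in> borel_measurable borel" and g: "\<And>x. 0 \<le> g x"
    and B: "(\<integral>\<^sup>+x. ennreal (g x powr conjugate_exponent p) \<partial>lebesgue) \<le> ennreal B" "0 < B"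
  shows "(\<integral>\<^sup>+x. ennreal (\<bar>f x\<bar> * g x) \<partial>lebesgue) \<le>
    ennreal (Lp_norm p f * B powr (1 / conjugate_exponent p))"
proof -
  have [measurable]: "f \<in> borel_measurable lebesgue" using f by (simp add: Lp_space_def)
  have [measurable]: "g \<in> borel_measurable lebesgue"
    using g_borel by (intro measurable_completion) simp
  have "(\<integral>\<^sup>+x. ennreal (\<bar>f x\<bar> * g x) \<partial>lebesgue) \<le>
    ennreal ((Lp_norm p f powr p) powr (1 / p) * B powr (1 / conjugate_exponent p))"
    using f p g B conjugate_exponent_props[OF p]
    by (intro nn_integral_Holder) (auto simp: nn_integral_Lp)
  then show ?thesis using p Lp_norm_nonneg[of p f] by (simp add: powr_powr)
qed


section \<open>The near, middle and far parts of the kernel\<close>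

text \<open>With p' the conjugate exponent, the relation for \<beta> says N - \<beta> p' = p'. The
  p'-th power of the kernel therefore has integral proportional to \<open>r powr p'\<close> over the
  ball, and the p'-th root gives exactly one factor \<open>r\<close>.\<close>

lemma Lp_ball_kernel_bound:
  fixes x :: "real ^ 'n::finite"
  assumes f: "f \<in> Lp_space p" and p: "1 < p" and r: "0 < r"
    and \<beta>: "(\<beta> + 1) * conjugate_exponent p = real CARD('n)"
  shows "(\<integral>\<^sup>+y. ennreal (\<bar>f y\<bar> * (if norm (x - y) \<le> r then norm (x - y) powr (- \<beta>) else 0)) \<partial>lebesgue)
    \<le> ennreal (Lp_norm p f * (r * (real CARD('n) * unit_ball_vol (real CARD('n)) /
        conjugate_exponent p) powr (1 / conjugate_exponent p)))"
proof -
  let ?p' = "conjugate_exponent p" and ?c = "real CARD('n) * unit_ball_vol (real CARD('n))"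
  note p' = conjugate_exponent_props[OF p]
  have \<beta>': "real CARD('n) - \<beta> * ?p' = ?p'"
    using \<beta> by (simp add: algebra_simps)
  have "(\<integral>\<^sup>+y. ennreal ((if norm (x - y) \<le> r then norm (x - y) powr (- \<beta>) else 0) powr ?p') \<partial>lebesgue)
      = (\<integral>\<^sup>+y. ennreal (if norm (x - y) \<le> r then norm (x - y) powr (- (\<beta> * ?p')) else 0) \<partial>lebesgue)"
    by (intro nn_integral_cong) (simp add: powr_powr)
  also have "\<dots> = ennreal (?c * (r powr ?p' / ?p'))"
    using nn_integral_norm_powr_ball[of r "\<beta> * ?p'" x] r p' \<beta>' by simp
  finally have "(\<integral>\<^sup>+y. ennreal (\<bar>f y\<bar> * (if norm (x - y) \<le> r then norm (x - y) powr (- \<beta>) else 0)) \<partial>lebesgue)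
    \<le> ennreal (Lp_norm p f * (?c * (r powr ?p' / ?p')) powr (1 / ?p'))"
    using f p r p' by (intro Lp_Holder) auto
  also have "(?c * (r powr ?p' / ?p')) powr (1 / ?p') = (r powr ?p' * (?c / ?p')) powr (1 / ?p')"
    by (simp add: mult_ac)
  also have "\<dots> = r * (?c / ?p') powr (1 / ?p')"
    using r p' by (subst powr_mult) (auto simp: powr_powr)
  finally show ?thesis .
qed

text \<open>The choice of \<open>s\<close> makes the conjugate power of the kernel the borderline
  power of the distance, so Hoelder's inequality yields a root of the logarithm. For
  \<open>r > 1\<close> the annulus is empty.\<close>

lemma Lp_annulus_kernel_bound:
  fixes x :: "real ^ 'n::finite"
  assumes f: "f \<in> Lp_space p" and p: "1 < p" and r: "0 < r"
    and s: "s * conjugate_exponent p = real CARD('n)"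
  shows "(\<integral>\<^sup>+y. ennreal (\<bar>f y\<bar> * (if r \<le> norm (x - y) \<and> norm (x - y) \<le> 1
      then norm (x - y) powr (- s) else 0)) \<partial>lebesgue)
    \<le> ennreal (Lp_norm p f * ((real CARD('n) * unit_ball_vol (real CARD('n))) powr (1 / conjugate_exponent p)
        * (\<bar>ln r\<bar> + 1) powr (1 / conjugate_exponent p)))"
proof (cases "r \<le> 1")
  case True
  let ?p' = "conjugate_exponent p" and ?c = "real CARD('n) * unit_ball_vol (real CARD('n))"
  have "(\<integral>\<^sup>+y. ennreal ((if r \<le> norm (x - y) \<and> norm (x - y) \<le> 1
        then norm (x - y) powr (- s) else 0) powr ?p') \<partial>lebesgue)
      = (\<integral>\<^sup>+y. ennreal (if r \<le> norm (x - y) \<and> norm (x - y) \<le> 1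
        then norm (x - y) powr (- real CARD('n)) else 0) \<partial>lebesgue)"
    using s by (intro nn_integral_cong) (simp add: powr_powr)
  also have "\<dots> = ennreal (?c * (- ln r))"
    using nn_integral_norm_powr_annulus[of r 1 x] r True by (simp cong: if_cong)
  \<comment> \<open>Adding 1 keeps the bound strictly positive even at \<open>r = 1\<close>, as
    \<open>Lp_Holder\<close> requires.\<close>
  also have "\<dots> \<le> ennreal (?c * (\<bar>ln r\<bar> + 1))"
    by (intro ennreal_leI mult_left_mono) auto
  finally have "(\<integral>\<^sup>+y. ennreal (\<bar>f y\<bar> * (if r \<le> norm (x - y) \<and> norm (x - y) \<le> 1
      then norm (x - y) powr (- s) else 0)) \<partial>lebesgue)
    \<le> ennreal (Lp_norm p f * (?c * (\<bar>ln r\<bar> + 1)) powr (1 / ?p'))"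
    using f p by (intro Lp_Holder) auto
  then show ?thesis by (subst (asm) powr_mult) auto
next
  case False
  then have "(\<integral>\<^sup>+y. ennreal (\<bar>f y\<bar> * (if r \<le> norm (x - y) \<and> norm (x - y) \<le> 1
      then norm (x - y) powr (- s) else 0)) \<partial>lebesgue) = (\<integral>\<^sup>+y. 0 \<partial>(lebesgue :: (real ^ 'n) measure))"
    by (intro nn_integral_cong) auto
  then show ?thesis by simp
qed

text \<open>The constant is uniform in \<open>f\<close> and \<open>x\<close>, because the kernel
  integral is invariant under translation. For \<open>q > 1\<close> Hoelder's inequality applies,
  since the conjugate power of the kernel is integrable away from \<open>x\<close>.\<close>

lemma Lp_tail_kernel_bound:
  assumes q: "1 \<le> q" and s: "0 \<le> s" "1 < q \<Longrightarrow> real CARD('n::finite) < s * conjugate_exponent q"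
  obtains C where "0 \<le> C"
    "\<And>(f :: real ^ 'n \<Rightarrow> real) x. f \<in> Lp_space q \<Longrightarrow>
      (\<integral>\<^sup>+y. ennreal (\<bar>f y\<bar> * (if 1 \<le> norm (x - y) then norm (x - y) powr (- s) else 0)) \<partial>lebesgue)
      \<le> ennreal (Lp_norm q f * C)"
proof (cases "q = 1")
  \<comment> \<open>For \<open>q = 1\<close> the term \<open>conjugate_exponent q\<close> is
    \<open>1 / 0 = 0\<close>, not infinity. Instead of Hoelder's inequality, the bound of the kernel
    by 1 is used.\<close>
  case True
  show thesis
  proof
    fix f :: "real ^ 'n \<Rightarrow> real" and x :: "real ^ 'n"
    assume f: "f \<in> Lp_space q"
    have "(\<integral>\<^sup>+y. ennreal (\<bar>f y\<bar> * (if 1 \<le> norm (x - y) then norm (x - y) powr (- s) else 0)) \<partial>lebesgue)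
      \<le> (\<integral>\<^sup>+y. ennreal (\<bar>f y\<bar> powr q) \<partial>lebesgue)"
    proof (intro nn_integral_mono ennreal_leI)
      fix y
      have "norm (x - y) powr (- s) \<le> 1 powr (- s)" if "1 \<le> norm (x - y)"
        using that s by (intro powr_mono2') auto
      then show "\<bar>f y\<bar> * (if 1 \<le> norm (x - y) then norm (x - y) powr (- s) else 0) \<le> \<bar>f y\<bar> powr q"
        using True by (auto intro: mult_left_le)
    qed
    also have "\<dots> = ennreal (Lp_norm q f * 1)"
      using nn_integral_Lp[of f q] f True by (simp add: Lp_norm_nonneg)
    finally show "(\<integral>\<^sup>+y. ennreal (\<bar>f y\<bar> * (if 1 \<le> norm (x - y)
      then norm (x - y) powr (- s) else 0)) \<partial>lebesgue) \<le> ennreal (Lp_norm q f * 1)" .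
  qed simp
next
  case False
  with q have q1: "1 < q" by simp
  let ?q' = "conjugate_exponent q"
  define B where "B = real CARD('n) * unit_ball_vol (real CARD('n)) * (1 / (s * ?q' - real CARD('n)))"
  show thesis
  proof
    fix f :: "real ^ 'n \<Rightarrow> real" and x :: "real ^ 'n"
    assume f: "f \<in> Lp_space q"
    have "(\<integral>\<^sup>+y. ennreal ((if 1 \<le> norm (x - y) then norm (x - y) powr (- s) else 0) powr ?q') \<partial>lebesgue)
        = (\<integral>\<^sup>+y. ennreal (if 1 \<le> norm (x - y) then norm (x - y) powr (- (s * ?q')) else 0) \<partial>lebesgue)"
      by (intro nn_integral_cong) (simp add: powr_powr)
    also have "\<dots> = ennreal B"
      using nn_integral_norm_powr_outside_ball[of 1 "s * ?q'" x] s(2)[OF q1] by (simp add: B_def)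
    finally show "(\<integral>\<^sup>+y. ennreal (\<bar>f y\<bar> * (if 1 \<le> norm (x - y)
        then norm (x - y) powr (- s) else 0)) \<partial>lebesgue) \<le> ennreal (Lp_norm q f * B powr (1 / ?q'))"
      using f q1 s(2)[OF q1] by (intro Lp_Holder) (auto simp: B_def)
  qed simp
qed

section \<open>Splitting and reassembling the kernel difference\<close>

text \<open>If \<open>a \<le> 2 * h\<close>, the triangle inequality gives
  \<open>b \<le> 3 * h\<close>, and the two singular terms are kept separately in balls about their
  own centres. Otherwise the mean value estimate applies, and its kernel is cut at distance 1. The
  middle piece starts at \<open>h\<close> instead of \<open>2 * h\<close>, so that its logarithm is
  that of \<open>h\<close> itself.\<close>

lemma norm_powr_diff_le_split:
  fixes x y z :: "'a::real_normed_vector"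
  defines "h \<equiv> norm (x - z)" and "a \<equiv> norm (x - y)" and "b \<equiv> norm (z - y)"
  assumes "0 < \<beta>" "x \<noteq> z"
  shows "\<bar>1 / a powr \<beta> - 1 / b powr \<beta>\<bar> \<le>
    (if a \<le> 2 * h then a powr (- \<beta>) else 0) + (if b \<le> 3 * h then b powr (- \<beta>) else 0)
    + \<beta> * 2 powr (\<beta> + 1) * h * ((if h \<le> a \<and> a \<le> 1 then a powr (- (\<beta> + 1)) else 0)
      + (if 1 \<le> a then a powr (- (\<beta> + 1)) else 0))"
proof -
  have h: "0 < h" using assms by simp
  have ab: "\<bar>a - b\<bar> \<le> h"
    using norm_triangle_ineq3[of "x - y" "z - y"] by (simp add: a_def b_def h_def)
  define K where "K = \<beta> * 2 powr (\<beta> + 1) * h"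
  define T where "T = (if h \<le> a \<and> a \<le> 1 then a powr (- (\<beta> + 1)) else 0)
      + (if 1 \<le> a then a powr (- (\<beta> + 1)) else 0)"
  have K: "0 \<le> K" using assms h by (simp add: K_def)
  have "\<bar>1 / a powr \<beta> - 1 / b powr \<beta>\<bar> \<le> (if a \<le> 2 * h then a powr (- \<beta>) else 0)
      + (if b \<le> 3 * h then b powr (- \<beta>) else 0) + K * T"
  proof (cases "a \<le> 2 * h")
    case True
    then have "b \<le> 3 * h" using ab by simp
    moreover have "\<bar>1 / a powr \<beta> - 1 / b powr \<beta>\<bar> \<le> a powr (- \<beta>) + b powr (- \<beta>)"
      unfolding powr_minus_divide by (rule order_trans[OF abs_triangle_ineq4]) simp
    moreover have "0 \<le> K * T"
      using K by (simp add: T_def)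
    ultimately show ?thesis using True by simp
  next
    case False
    then have "\<bar>1 / a powr \<beta> - 1 / b powr \<beta>\<bar> \<le> K * a powr (- (\<beta> + 1))"
      unfolding K_def using assms(4) h ab by (intro inverse_powr_diff_bound) auto
    \<comment> \<open>Since \<open>a > 2 * h > h\<close>, at least one of the two conditions in
      \<open>T\<close> holds.\<close>
    also have "\<dots> \<le> K * T"
      using K False h by (intro mult_left_mono) (auto simp: T_def)
    finally show ?thesis using False by (simp add: add_increasing)
  qed
  then show ?thesis unfolding K_def T_def .
qed


text \<open>The pointwise splitting is integrated against \<bar>f\<bar> and each piece is bounded by
  its own lemma. Stated as a nonnegative integral, the result later provides both the integrability
  and the size of the difference.\<close>

lemma kernel_difference_bound:
  fixes p q \<beta> :: real
  assumes p: "1 < p" and q: "1 \<le> q" "q < p" and \<beta>: "0 < \<beta>"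
    and \<beta>_eq: "(\<beta> + 1) * conjugate_exponent p = real CARD('n::finite)"
  obtains C where "0 \<le> C"
    "\<And>(f :: real ^ 'n \<Rightarrow> real) x z. f \<in> Lp_space p \<inter> Lp_space q \<Longrightarrow> x \<noteq> z \<Longrightarrow>
      (\<integral>\<^sup>+y. ennreal (\<bar>f y\<bar> * \<bar>1 / norm (x - y) powr \<beta> - 1 / norm (z - y) powr \<beta>\<bar>) \<partial>lebesgue)
      \<le> ennreal (C * norm (x - z) * (\<bar>ln (norm (x - z))\<bar> + 1) powr (1 / conjugate_exponent p)
          * (Lp_norm q f + Lp_norm p f))"
proof -
  let ?p' = "conjugate_exponent p" and ?c = "real CARD('n) * unit_ball_vol (real CARD('n))"
  note p' = conjugate_exponent_props[OF p]
  \<comment> \<open>Conjugation reverses order: \<open>q < p\<close> makes the conjugate of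
    \<open>q\<close> the larger one, so the borderline equality for \<open>p\<close> becomes a
    strict inequality for \<open>q\<close>.\<close>
  have tail: "real CARD('n) < (\<beta> + 1) * conjugate_exponent q" if "1 < q"
  proof -
    have "?p' < conjugate_exponent q"
      using that q by (simp add: conjugate_exponent_def field_simps)
    then show ?thesis using \<beta> by (simp flip: \<beta>_eq)
  qed
  obtain C3 where C3: "0 \<le> C3"
    "\<And>(f :: real ^ 'n \<Rightarrow> real) x. f \<in> Lp_space q \<Longrightarrow>
      (\<integral>\<^sup>+y. ennreal (\<bar>f y\<bar> * (if 1 \<le> norm (x - y) then norm (x - y) powr (- (\<beta> + 1)) else 0)) \<partial>lebesgue)
      \<le> ennreal (Lp_norm q f * C3)"
    using Lp_tail_kernel_bound[OF q(1) _ tail] \<beta> by auto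
  define D1 where "D1 = (?c / ?p') powr (1 / ?p')"
  define D2 where "D2 = ?c powr (1 / ?p')"
  define K where "K = \<beta> * 2 powr (\<beta> + 1)"
  have nonneg: "0 \<le> D1" "0 \<le> D2" "0 \<le> K" using \<beta> by (auto simp: D1_def D2_def K_def)
  show thesis
  proof
    \<comment> \<open>The 5 is 2 + 3, from the balls of radii \<open>2 * h\<close> and
      \<open>3 * h\<close>. The other two terms come from the annulus and the tail.\<close>
    show "0 \<le> 5 * D1 + K * D2 + K * C3" using nonneg C3(1) by simp
  next
    fix f :: "real ^ 'n \<Rightarrow> real" and x z :: "real ^ 'n"
    assume f: "f \<in> Lp_space p \<inter> Lp_space q" and "x \<noteq> z"
    have [measurable]: "f \<in> borel_measurable lebesgue" using f by (simp add: Lp_space_def)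
    define h where "h = norm (x - z)"
    have h: "0 < h" using \<open>x \<noteq> z\<close> by (simp add: h_def)
    define L where "L = (\<bar>ln h\<bar> + 1) powr (1 / ?p')"
    \<comment> \<open>This lets the ball and tail terms, which carry no logarithm, absorb the factor
      \<open>L\<close>.\<close>
    have L: "1 \<le> L" unfolding L_def using p' by (intro ge_one_powr_ge_zero) auto
    let ?P = "Lp_norm p f" and ?Q = "Lp_norm q f"
    define k1 where "k1 y = (if norm (x - y) \<le> 2 * h then norm (x - y) powr (- \<beta>) else 0)" for y
    define k2 where "k2 y = (if norm (z - y) \<le> 3 * h then norm (z - y) powr (- \<beta>) else 0)" for y
    define k3 where "k3 y = (if h \<le> norm (x - y) \<and> norm (x - y) \<le> 1
      then norm (x - y) powr (- (\<beta> + 1)) else 0)" for y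
    define k4 where "k4 y = (if 1 \<le> norm (x - y) then norm (x - y) powr (- (\<beta> + 1)) else 0)" for y
    have k_borel: "k1 \<in> borel_measurable lborel" "k2 \<in> borel_measurable lborel"
      "k3 \<in> borel_measurable lborel" "k4 \<in> borel_measurable lborel"
      unfolding k1_def k2_def k3_def k4_def by measurable
    note [measurable] = k_borel[THEN measurable_completion]
    have k_nonneg: "0 \<le> k1 y" "0 \<le> k2 y" "0 \<le> k3 y" "0 \<le> k4 y" for y
      by (auto simp: k1_def k2_def k3_def k4_def)
    have bounds:
      "(\<integral>\<^sup>+y. ennreal (\<bar>f y\<bar> * k1 y) \<partial>lebesgue) \<le> ennreal (?P * (2 * h * D1))"
      "(\<integral>\<^sup>+y. ennreal (\<bar>f y\<bar> * k2 y) \<partial>lebesgue) \<le> ennreal (?P * (3 * h * D1))"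
      "(\<integral>\<^sup>+y. ennreal (\<bar>f y\<bar> * k3 y) \<partial>lebesgue) \<le> ennreal (?P * (D2 * L))"
      "(\<integral>\<^sup>+y. ennreal (\<bar>f y\<bar> * k4 y) \<partial>lebesgue) \<le> ennreal (?Q * C3)"
      unfolding k1_def k2_def k3_def k4_def D1_def D2_def L_def
      using f p h \<beta>_eq C3(2) by (auto intro!: Lp_ball_kernel_bound Lp_annulus_kernel_bound)
    have "(\<integral>\<^sup>+y. ennreal (\<bar>f y\<bar> * \<bar>1 / norm (x - y) powr \<beta> - 1 / norm (z - y) powr \<beta>\<bar>) \<partial>lebesgue)
      \<le> (\<integral>\<^sup>+y. ennreal (\<bar>f y\<bar> * k1 y) + ennreal (\<bar>f y\<bar> * k2 y)
          + ennreal (K * h) * (ennreal (\<bar>f y\<bar> * k3 y) + ennreal (\<bar>f y\<bar> * k4 y)) \<partial>lebesgue)"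
    proof (rule nn_integral_mono)
      fix y
      have "\<bar>f y\<bar> * \<bar>1 / norm (x - y) powr \<beta> - 1 / norm (z - y) powr \<beta>\<bar> \<le>
          \<bar>f y\<bar> * (k1 y + k2 y + K * h * (k3 y + k4 y))"
        unfolding k1_def k2_def k3_def k4_def K_def h_def
        by (intro mult_left_mono norm_powr_diff_le_split \<beta> \<open>x \<noteq> z\<close>) auto
      also have "\<dots> = \<bar>f y\<bar> * k1 y + \<bar>f y\<bar> * k2 y + K * h * (\<bar>f y\<bar> * k3 y + \<bar>f y\<bar> * k4 y)"
        by (simp add: algebra_simps)
      finally show "ennreal (\<bar>f y\<bar> * \<bar>1 / norm (x - y) powr \<beta> - 1 / norm (z - y) powr \<beta>\<bar>)
        \<le> ennreal (\<bar>f y\<bar> * k1 y) + ennreal (\<bar>f y\<bar> * k2 y)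
          + ennreal (K * h) * (ennreal (\<bar>f y\<bar> * k3 y) + ennreal (\<bar>f y\<bar> * k4 y))"
        using k_nonneg[of y] nonneg h by (simp add: ennreal_leI flip: ennreal_plus ennreal_mult)
    qed
    also have "\<dots> = (\<integral>\<^sup>+y. ennreal (\<bar>f y\<bar> * k1 y) \<partial>lebesgue) + (\<integral>\<^sup>+y. ennreal (\<bar>f y\<bar> * k2 y) \<partial>lebesgue)
      + ennreal (K * h) * ((\<integral>\<^sup>+y. ennreal (\<bar>f y\<bar> * k3 y) \<partial>lebesgue) + (\<integral>\<^sup>+y. ennreal (\<bar>f y\<bar> * k4 y) \<partial>lebesgue))"
      by (simp add: nn_integral_add nn_integral_cmult)
    also have "\<dots> \<le> ennreal (?P * (2 * h * D1)) + ennreal (?P * (3 * h * D1))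
      + ennreal (K * h) * (ennreal (?P * (D2 * L)) + ennreal (?Q * C3))"
      by (intro add_mono mult_left_mono bounds) auto
    also have "\<dots> = ennreal (?P * (2 * h * D1) + ?P * (3 * h * D1) + K * h * (?P * (D2 * L) + ?Q * C3))"
      using nonneg h L C3(1) by (simp add: Lp_norm_nonneg flip: ennreal_plus ennreal_mult)
    also have "\<dots> \<le> ennreal ((5 * D1 + K * D2 + K * C3) * h * L * (?Q + ?P))"
    proof (rule ennreal_leI)
      have "?P * (2 * h * D1) + ?P * (3 * h * D1) + K * h * (?P * (D2 * L) + ?Q * C3)
        = 5 * D1 * h * (1 * ?P) + K * D2 * h * (L * ?P) + K * C3 * h * (1 * ?Q)"
        by algebra
      also have "\<dots> \<le> 5 * D1 * h * (L * (?Q + ?P)) + K * D2 * h * (L * (?Q + ?P)) + K * C3 * h * (L * (?Q + ?P))"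
        using nonneg h L C3(1) by (intro add_mono mult_left_mono mult_mono) (auto simp: Lp_norm_nonneg)
      also have "\<dots> = (5 * D1 + K * D2 + K * C3) * h * L * (?Q + ?P)"
        by algebra
      finally show "?P * (2 * h * D1) + ?P * (3 * h * D1) + K * h * (?P * (D2 * L) + ?Q * C3) \<le> \<dots>" .
    qed
    finally show "(\<integral>\<^sup>+y. ennreal (\<bar>f y\<bar> * \<bar>1 / norm (x - y) powr \<beta> - 1 / norm (z - y) powr \<beta>\<bar>) \<partial>lebesgue)
      \<le> ennreal ((5 * D1 + K * D2 + K * C3) * norm (x - z)
          * (\<bar>ln (norm (x - z))\<bar> + 1) powr (1 / ?p') * (?Q + ?P))"
      unfolding h_def L_def .
  qed
qed

section \<open>From kernel differences to differences of potentials\<close>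

theorem theoremA:
  fixes p \<alpha> q :: real
  assumes "1 < p"
    and "\<alpha> = 1 + real CARD('n::finite) / p"
    and "\<alpha> < real CARD('n)"
    and "1 \<le> q" and "q < p"
  shows "\<exists>C::real. \<forall>f \<in> Lp_space p \<inter> Lp_space q. \<forall>x z :: real ^ 'n.
    \<bar>modified_riesz_potential \<alpha> f x - modified_riesz_potential \<alpha> f z\<bar>
      \<le> C * norm (x - z) * (\<bar>ln (norm (x - z))\<bar> + 1) powr (1 / conjugate_exponent p)
          * (Lp_norm q f + Lp_norm p f)"
proof -
  define \<beta> where "\<beta> = real CARD('n) - \<alpha>"
  \<comment> \<open>Here \<beta> + 1 = N - N / p = N (1 - 1 / p), which is N divided by the
    conjugate exponent.\<close>
  have \<beta>: "0 < \<beta>" "(\<beta> + 1) * conjugate_exponent p = real CARD('n)"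
    using assms by (simp_all add: \<beta>_def conjugate_exponent_def field_simps)
  obtain C where C: "0 \<le> C"
    "\<And>(f :: real ^ 'n \<Rightarrow> real) x z. f \<in> Lp_space p \<inter> Lp_space q \<Longrightarrow> x \<noteq> z \<Longrightarrow>
      (\<integral>\<^sup>+y. ennreal (\<bar>f y\<bar> * \<bar>1 / norm (x - y) powr \<beta> - 1 / norm (z - y) powr \<beta>\<bar>) \<partial>lebesgue)
      \<le> ennreal (C * norm (x - z) * (\<bar>ln (norm (x - z))\<bar> + 1) powr (1 / conjugate_exponent p)
          * (Lp_norm q f + Lp_norm p f))"
    using kernel_difference_bound[OF assms(1,4,5) \<beta>] by blast
  let ?\<gamma> = "riesz_const CARD('n) \<alpha>"
  show ?thesis
  proof (intro exI ballI allI)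
    fix f :: "real ^ 'n \<Rightarrow> real" and x z :: "real ^ 'n"
    assume f: "f \<in> Lp_space p \<inter> Lp_space q"
    then have f_meas [measurable]: "f \<in> borel_measurable lebesgue" by (simp add: Lp_space_def)
    let ?k = "\<lambda>x y. 1 / norm (x - y) powr \<beta>"
    let ?R = "C * norm (x - z) * (\<bar>ln (norm (x - z))\<bar> + 1) powr (1 / conjugate_exponent p)
          * (Lp_norm q f + Lp_norm p f)"
    have k_meas [measurable]: "?k v \<in> borel_measurable lebesgue" for v :: "real ^ 'n"
      by (intro measurable_completion) measurable
    \<comment> \<open>With \<open>w = 0\<close> this is absolute convergence of the integral
      defining the potential at \<open>v\<close>. It justifies subtracting two potentials under one
      integral, where the terms centred at 0 cancel.\<close>
    have int: "integrable lebesgue (\<lambda>y. f y * (?k v y - ?k w y))" for v w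
    proof (cases "v = w")
      case False
      have "(\<integral>\<^sup>+y. ennreal (norm (f y * (?k v y - ?k w y))) \<partial>lebesgue) < \<infinity>"
        unfolding real_norm_def abs_mult
        by (rule le_less_trans[OF C(2)[OF f False]]) simp
      then show ?thesis by (intro integrableI_bounded) auto
    qed simp
    have potential: "modified_riesz_potential \<alpha> f v =
        ?\<gamma> * (LINT y|lebesgue. f y * (?k v y - ?k 0 y))" for v
      by (simp add: modified_riesz_potential_def \<beta>_def)
    have "modified_riesz_potential \<alpha> f x - modified_riesz_potential \<alpha> f z =
        ?\<gamma> * (LINT y|lebesgue. f y * (?k x y - ?k 0 y) - f y * (?k z y - ?k 0 y))"
      unfolding potential by (subst Bochner_Integration.integral_diff[OF int int]) (simp add: right_diff_distrib)
    also have "\<dots> = ?\<gamma> * (LINT y|lebesgue. f y * (?k x y - ?k z y))"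
      by (simp add: algebra_simps)
    finally have diff: "modified_riesz_potential \<alpha> f x - modified_riesz_potential \<alpha> f z =
        ?\<gamma> * (LINT y|lebesgue. f y * (?k x y - ?k z y))" .
    have "\<bar>LINT y|lebesgue. f y * (?k x y - ?k z y)\<bar> \<le> ?R"
    \<comment> \<open>For \<open>x = z\<close> both sides are 0: the kernels coincide, and the
      factor \<open>norm (x - z)\<close> vanishes whatever value \<open>ln 0\<close> has.\<close>
    proof (cases "x = z")
      case False
      have "ennreal \<bar>LINT y|lebesgue. f y * (?k x y - ?k z y)\<bar>
          \<le> (\<integral>\<^sup>+y. ennreal (norm (f y * (?k x y - ?k z y))) \<partial>lebesgue)"
        using integral_norm_bound_ennreal[OF int] by simp
      also have "\<dots> \<le> ennreal ?R"
        unfolding real_norm_def abs_mult by (rule C(2)[OF f False])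
      finally show ?thesis
        using C(1) by (subst (asm) ennreal_le_iff) (auto simp: Lp_norm_nonneg intro!: mult_nonneg_nonneg add_nonneg_nonneg)
    qed simp
    \<comment> \<open>The normalising factor enters the final constant through its absolute value,
      which covers either sign.\<close>
    then have "\<bar>?\<gamma>\<bar> * \<bar>LINT y|lebesgue. f y * (?k x y - ?k z y)\<bar> \<le> \<bar>?\<gamma>\<bar> * ?R"
      by (rule mult_left_mono) simp
    then show "\<bar>modified_riesz_potential \<alpha> f x - modified_riesz_potential \<alpha> f z\<bar>
      \<le> (\<bar>?\<gamma>\<bar> * C) * norm (x - z) * (\<bar>ln (norm (x - z))\<bar> + 1) powr (1 / conjugate_exponent p)
          * (Lp_norm q f + Lp_norm p f)"
      unfolding diff abs_mult by (simp only: mult.assoc)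
  qed
qed

end
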